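(* Let $G$ be a tree of order $n$ and let $f:\mathbb{R}^n\to\mathbb{R}^n$ be an admissible vector field on $G$ with an equilibrium at the origin, whose linearization at the origin has internal dynamics coefficient $\alpha$ common to all cells. Then $\alpha$ is an eigenvalue of $d_0f$ with algebraic multiplicity at least $n-2\nu(G)$, where $\nu(G)$ is the number of edges of a maximum matching of $G$ (when $n-2\nu(G)=0$ nothing is asserted).
   Context: Graphs are finite and simple (undirected, one type of vertex and edge, no multiple edges, no loops). A tree is a connected graph without cycles. Write $V(G)=\{v_1,\ldots,v_n\}$; $c\sim v$ means adjacency, $\deg(c)$ is the number of neighbors of $c$, and $A$ is the adjacency matrix. Each cell has phase space $\mathbb{R}$. A differentiable vector field $f$ on $\mathbb{R}^n$ is admissible if for each cell $c$ the component $f_c(x)$ depends only on $x_c$ and the variables $x_v$, $v\sim c$, and cells with the same degree have the same component function up to relabelling of inputs by any bijection between their neighbor sets (in particular the function is symmetric in the neighbor variables). If $f(0)=0$, then $(d_0f)_c(x)=\alpha_{\deg(c)}x_c+\beta_{\deg(c)}\sum_{v\sim c}x_v$ with real coefficients depending only on the degree. It is assumed throughout that all the $\alpha_i$ coincide, with common value $\alpha$; thus $d_0f=DA+\alpha\,\mathrm{Id}$ with $D=\operatorname{diag}(\beta_{\deg(v_1)},\ldots,\beta_{\deg(v_n)})$. A matching is a set of edges no two of which share a vertex; a maximum matching is one with the largest number of edges. *)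

theory Defs
  imports "HOL-Analysis.Analysis" "HOL-Computational_Algebra.Polynomial"
begin

section \<open>Graphs\<close>

text \<open>
  A graph of order \<^term>\<open>CARD('n)\<close> has the finite type \<open>'n\<close> as its set of vertices and is given
  by its adjacency relation.
\<close>

definition simple_graph :: "('n \<Rightarrow> 'n \<Rightarrow> bool) \<Rightarrow> bool" where
  "simple_graph E \<longleftrightarrow> symp E \<and> irreflp E"

definition neighbors :: "('n \<Rightarrow> 'n \<Rightarrow> bool) \<Rightarrow> 'n \<Rightarrow> 'n set" where
  "neighbors E c = {v. E c v}"

definition degree_of :: "('n \<Rightarrow> 'n \<Rightarrow> bool) \<Rightarrow> 'n \<Rightarrow> nat" where
  "degree_of E c = card (neighbors E c)"

definition graph_connected :: "('n \<Rightarrow> 'n \<Rightarrow> bool) \<Rightarrow> bool" where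
  "graph_connected E \<longleftrightarrow> (\<forall>u v. E\<^sup>*\<^sup>* u v)"

text \<open>
  A cycle is listed by its vertices, without repeating the first one at the end. Requiring at least
  three vertices excludes traversing one edge back and forth.
\<close>

definition graph_cycle :: "('n \<Rightarrow> 'n \<Rightarrow> bool) \<Rightarrow> 'n list \<Rightarrow> bool" where
  "graph_cycle E vs \<longleftrightarrow>
     length vs \<ge> 3 \<and> distinct vs \<and> successively E vs \<and> E (last vs) (hd vs)"

definition is_tree :: "('n \<Rightarrow> 'n \<Rightarrow> bool) \<Rightarrow> bool" where
  "is_tree E \<longleftrightarrow> simple_graph E \<and> graph_connected E \<and> (\<nexists>vs. graph_cycle E vs)"

definition edges :: "('n \<Rightarrow> 'n \<Rightarrow> bool) \<Rightarrow> 'n set set" where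
  "edges E = {{u, v} | u v. E u v}"

definition matching :: "('n \<Rightarrow> 'n \<Rightarrow> bool) \<Rightarrow> 'n set set \<Rightarrow> bool" where
  "matching E M \<longleftrightarrow> M \<subseteq> edges E \<and> pairwise disjnt M"

definition matching_number :: "('n::finite \<Rightarrow> 'n \<Rightarrow> bool) \<Rightarrow> nat" where
  "matching_number E = Max (card ` {M. matching E M})"


section \<open>Admissible vector fields\<close>

text \<open>
  The last clause, taken at \<open>d = c\<close>, is the symmetry of \<open>f\<^sub>c\<close> in the variables of the
  neighbors of \<open>c\<close>.
\<close>

definition admissible ::
  "('n::finite \<Rightarrow> 'n \<Rightarrow> bool) \<Rightarrow> (real ^ 'n \<Rightarrow> real ^ 'n) \<Rightarrow> bool" where
  "admissible E f \<longleftrightarrow>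
     (\<forall>x. f differentiable (at x)) \<and>
     (\<forall>c x y. x $ c = y $ c \<and> (\<forall>v \<in> neighbors E c. x $ v = y $ v) \<longrightarrow> f x $ c = f y $ c) \<and>
     (\<forall>c d. degree_of E c = degree_of E d \<longrightarrow>
        (\<forall>\<sigma>. bij_betw \<sigma> (neighbors E c) (neighbors E d) \<longrightarrow>
           (\<forall>x y. x $ c = y $ d \<and> (\<forall>v \<in> neighbors E c. x $ v = y $ \<sigma> v) \<longrightarrow>
              f x $ c = f y $ d)))"

text \<open>
  The internal dynamics coefficient of the cell \<open>c\<close> is the coefficient of \<open>x\<^sub>c\<close> in the
  \<open>c\<close>-th component of the linearization at the origin, i.e. a diagonal entry of the Jacobian matrix.
\<close>

definition internal_coeff :: "(real ^ 'n \<Rightarrow> real ^ 'n::finite) \<Rightarrow> 'n \<Rightarrow> real" where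
  "internal_coeff f c = jacobian f (at 0) $ c $ c"


section \<open>Eigenvalues\<close>

definition is_eigenvalue :: "'a::field ^ 'n ^ 'n \<Rightarrow> 'a \<Rightarrow> bool" where
  "is_eigenvalue A k \<longleftrightarrow> (\<exists>v. v \<noteq> 0 \<and> A *v v = k *s v)"

text \<open>The characteristic polynomial is the determinant of \<open>X I - A\<close> over the polynomial ring.\<close>

definition charpoly :: "'a::field ^ 'n ^ 'n \<Rightarrow> 'a poly" where
  "charpoly A = det (mat [:0, 1:] - map_matrix (\<lambda>a. [:a:]) A)"

definition alg_multiplicity :: "'a::field ^ 'n ^ 'n \<Rightarrow> 'a \<Rightarrow> nat" where
  "alg_multiplicity A k = Polynomial.order k (charpoly A)"

end

theory Submission
  imports Defs "HOL-Combinatorics.Cycles"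
begin

text \<open>
  Expand \<open>det (X I - J)\<close>, where \<open>J\<close> is the Jacobian matrix at the origin, by the Leibniz formula.
  Off the diagonal \<open>J\<close> is supported on the edges of the tree, so a permutation with a nonzero
  contribution moves every vertex to itself or to a neighbor. As there are no graph cycles, such a
  permutation is an involution, and its 2-cycles form a matching. It therefore has at least
  \<open>n - 2 \<nu>(G)\<close> fixed points, each of which contributes a factor \<open>X - \<alpha>\<close>.
\<close>

text \<open>Evaluation at \<open>x\<close> is a ring homomorphism, so it commutes with the Leibniz
  expansion.\<close>

lemma poly_charpoly: "poly (charpoly A) x = det (mat x - A)"
proof -
  have "poly ((mat [:0, 1:] - map_matrix (\<lambda>a. [:a:]) A) $ i $ j) x = (mat x - A) $ i $ j" for i j
    by (simp add: mat_def)
  then show ?thesis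
    by (simp add: charpoly_def det_def poly_sum poly_prod del: vector_minus_component)
qed

lemma mat_mult_vec: "mat k *v v = k *s (v :: 'a::semiring_1 ^ 'n)"
proof -
  have "(\<Sum>j\<in>UNIV. (if i = j then k else 0) * v $ j) = k * v $ i" for i
    by (simp add: if_distribR if_distrib[of "\<lambda>x. x * _"] cong: if_cong)
  then show ?thesis
    by (simp add: vec_eq_iff matrix_vector_mult_def mat_def)
qed

lemma is_eigenvalue_iff_root: "is_eigenvalue A k \<longleftrightarrow> poly (charpoly A) k = 0"
proof -
  have "det (mat k - A) = 0 \<longleftrightarrow> (\<exists>v. v \<noteq> 0 \<and> (mat k - A) *v v = 0)"
    using invertible_det_nz[of "mat k - A"] invertible_left_inverse[of "mat k - A"]
      matrix_left_invertible_ker[of "mat k - A"] by blast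
  also have "\<dots> \<longleftrightarrow> is_eigenvalue A k"
    by (metis (no_types) is_eigenvalue_def matrix_vector_mult_diff_rdistrib mat_mult_vec right_minus_eq)
  finally show ?thesis
    by (simp add: poly_charpoly)
qed

text \<open>A real number above an operator bound for \<open>A\<close> cannot be an eigenvalue,
  hence is no root. This makes the root order in \<open>alg_multiplicity\<close> meaningful.\<close>

lemma charpoly_nonzero: "charpoly (A :: real ^ 'n ^ 'n) \<noteq> 0"
proof
  assume "charpoly A = 0"
  obtain K where K: "\<And>v. norm (A *v v) \<le> K * norm v"
    using linear_bounded_pos[OF matrix_vector_mul_linear[of A]] by metis
  \<comment> \<open>The zero polynomial has every number as a root; \<open>\<bar>K\<bar> + 1\<close>
    exceeds \<open>K\<close> whatever its sign.\<close>
  from \<open>charpoly A = 0\<close> have "is_eigenvalue A (\<bar>K\<bar> + 1)"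
    by (simp add: is_eigenvalue_iff_root)
  then obtain v where v: "v \<noteq> 0" "A *v v = (\<bar>K\<bar> + 1) *\<^sub>R v"
    by (auto simp: is_eigenvalue_def scalar_mult_eq_scaleR)
  have "(\<bar>K\<bar> + 1) * norm v \<le> K * norm v"
    using K[of v] v by simp
  with v show False
    by simp
qed

text \<open>An orbit of \<open>p\<close> with at least three points would trace out a graph cycle,
  so every orbit has one or two points.\<close>

lemma edge_permutation_involution:
  fixes E :: "'n::finite \<Rightarrow> 'n \<Rightarrow> bool"
  assumes acyclic: "\<nexists>vs. graph_cycle E vs" and p: "p permutes UNIV"
    and step: "\<And>i. p i \<noteq> i \<Longrightarrow> E i (p i)"
  shows "p (p i) = i"
proof (rule ccontr)
  assume ne: "p (p i) \<noteq> i"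
  have perm: "permutation p"
    using p by (auto simp: permutation_permutes)
  \<comment> \<open>\<open>k\<close> is the length of the orbit of \<open>i\<close>, which
    \<open>support p i\<close> lists as \<open>i\<close>, \<open>p i\<close>, and so on up to the
    power \<open>k - 1\<close>.\<close>
  define k where "k = least_power p i"
  have period: "(p ^^ k) i = i" "k > 0"
    using least_power_of_permutation[OF perm] by (auto simp: k_def)
  have "p i \<noteq> i"
    using ne by auto
  then have "k \<noteq> 1"
    using period by auto
  moreover have "k \<noteq> 2"
    using period ne by (auto simp: numeral_2_eq_2)
  ultimately have k3: "k \<ge> 3"
    using period by linarith
  have inj: "inj (p ^^ j)" for j
    using p by (simp add: permutes_inj inj_fn)
  have edge: "E ((p ^^ j) i) ((p ^^ Suc j) i)" for j
  proof -
    have "(p ^^ j) (p i) \<noteq> (p ^^ j) i"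
      using inj[of j] \<open>p i \<noteq> i\<close> by (auto dest: injD)
    then show ?thesis
      using step[of "(p ^^ j) i"] by (simp add: funpow_swap1)
  qed
  have "distinct (support p i)"
    by (rule cycle_of_permutation[OF perm])
  moreover have "successively E (support p i)"
    using edge by (auto simp: successively_conv_nth)
  \<comment> \<open>The closing edge is the step from power \<open>k - 1\<close> to power
    \<open>k\<close>, which returns to \<open>i\<close>.\<close>
  moreover have "E (last (support p i)) (hd (support p i))"
    using edge[of "k - 1"] period k3
    by (auto simp: k_def[symmetric] last_map hd_map simp del: funpow.simps)
  ultimately have "graph_cycle E (support p i)"
    using k3 by (simp add: graph_cycle_def k_def)
  with acyclic show False
    by blast
qed

lemma card_le_matching_number: "matching E M \<Longrightarrow> card M \<le> matching_number E"
  unfolding matching_number_def by (rule Max_ge) auto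

text \<open>The 2-cycles of \<open>p\<close> are pairwise disjoint edges, and together they cover
  exactly the moved points, two per edge.\<close>

lemma card_moved_le_matching_number:
  fixes E :: "'n::finite \<Rightarrow> 'n \<Rightarrow> bool"
  assumes invol: "\<And>i. p (p i) = i" and step: "\<And>i. p i \<noteq> i \<Longrightarrow> E i (p i)"
  shows "card {i. p i \<noteq> i} \<le> 2 * matching_number E"
proof -
  define M where "M = (\<lambda>i. {i, p i}) ` {i. p i \<noteq> i}"
  have disj: "pairwise disjnt M"
  proof (rule pairwiseI)
    fix e e' assume "e \<in> M" "e' \<in> M" "e \<noteq> e'"
    then obtain i j where ij: "e = {i, p i}" "e' = {j, p j}" "{i, p i} \<noteq> {j, p j}"
      by (auto simp: M_def)
    \<comment> \<open>If two such pairs share a point, the involution forces them to share the other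
      point too.\<close>
    have "i \<noteq> j" "i \<noteq> p j" "p i \<noteq> j"
      using ij invol[of i] invol[of j] by auto
    moreover from this have "p i \<noteq> p j"
      using invol[of i] invol[of j] by auto
    ultimately show "disjnt e e'"
      by (simp add: ij disjnt_def)
  qed
  have "M \<subseteq> edges E"
    using step by (auto simp: M_def edges_def)
  with disj have "matching E M"
    by (simp add: matching_def)
  have "\<Union> M = {i. p i \<noteq> i}"
    by (auto simp: M_def invol)
  then have "card {i. p i \<noteq> i} = sum card M"
    using card_Union_disjoint[OF disj] by simp
  also have "\<dots> = (\<Sum>e\<in>M. 2)"
    by (rule sum.cong) (auto simp: M_def card_insert_if)
  also have "\<dots> = 2 * card M"
    by simp
  finally show ?thesis
    using card_le_matching_number[OF \<open>matching E M\<close>] by simp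
qed

text \<open>The purely matrix-theoretic part: only the zero pattern and the constant diagonal enter,
  not the values on the edges.\<close>

lemma alg_multiplicity_ge_forest:
  fixes A :: "real ^ 'n ^ 'n"
  assumes acyclic: "\<nexists>vs. graph_cycle E vs" and diag: "\<And>i. A $ i $ i = a"
    and offdiag: "\<And>i j. i \<noteq> j \<Longrightarrow> \<not> E i j \<Longrightarrow> A $ i $ j = 0"
  shows "CARD('n) - 2 * matching_number E \<le> alg_multiplicity A a"
proof -
  define B where "B = mat [:0, 1:] - map_matrix (\<lambda>x. [:x:]) A"
  have B_diag: "B $ i $ i = [:-a, 1:]" for i
    by (simp add: B_def mat_def diag)
  have B_offdiag: "B $ i $ j = 0" if "i \<noteq> j" "\<not> E i j" for i j
    using that by (simp add: B_def mat_def offdiag)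
  have "[:-a, 1:] ^ (CARD('n) - 2 * matching_number E) dvd (\<Prod>i\<in>UNIV. B $ i $ p i)"
    if p: "p permutes UNIV" for p
  proof (cases "\<forall>i. p i \<noteq> i \<longrightarrow> E i (p i)")
    case False
    then obtain i where "p i \<noteq> i" "\<not> E i (p i)"
      by blast
    then have "B $ i $ p i = 0"
      by (intro B_offdiag) auto
    then have "(\<Prod>i\<in>UNIV. B $ i $ p i) = 0"
      by (meson UNIV_I finite prod_zero)
    then show ?thesis
      by (simp only: dvd_0_right)
  next
    case True
    then have "p (p i) = i" for i
      using edge_permutation_involution[OF acyclic p] by blast
    then have "card {i. p i \<noteq> i} \<le> 2 * matching_number E"
      using True by (intro card_moved_le_matching_number) auto
    moreover have "card {i. p i = i} = CARD('n) - card {i. p i \<noteq> i}"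
      using card_Diff_subset[of "{i. p i \<noteq> i}" UNIV] by (simp add: Compl_eq_Diff_UNIV[symmetric] Collect_neg_eq)
    ultimately have "[:-a, 1:] ^ (CARD('n) - 2 * matching_number E) dvd [:-a, 1:] ^ card {i. p i = i}"
      by (intro le_imp_power_dvd) auto
    \<comment> \<open>Fixed points pick diagonal entries; the remaining factors only multiply this
      product.\<close>
    also have "\<dots> = (\<Prod>i | p i = i. B $ i $ p i)"
      by (simp add: B_diag)
    also have "\<dots> dvd (\<Prod>i\<in>UNIV. B $ i $ p i)"
      by (rule prod_dvd_prod_subset) auto
    finally show ?thesis .
  qed
  then have "[:-a, 1:] ^ (CARD('n) - 2 * matching_number E) dvd charpoly A"
    unfolding charpoly_def B_def[symmetric] det_def by (intro dvd_sum dvd_mult) auto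
  then show ?thesis
    using charpoly_nonzero[of A] by (simp add: order_divides alg_multiplicity_def)
qed

text \<open>Moving from the origin along axis \<open>v\<close> changes neither the variable of
  \<open>c\<close> nor those of its neighbors, so component \<open>c\<close> stays constant and its
  derivative vanishes.\<close>

lemma admissible_jacobian_eq_0:
  assumes f: "admissible E f" and "c \<noteq> v" and "\<not> E c v"
  shows "jacobian f (at 0) $ c $ v = 0"
proof -
  have "f differentiable (at 0)"
    using f by (simp add: admissible_def)
  \<comment> \<open>The origin is written as the point of the axis at parameter 0, to fit the chain
    rule.\<close>
  then have deriv: "(f has_derivative (\<lambda>h. jacobian f (at 0) *v h)) (at (0 *\<^sub>R axis v 1))"
    by (simp add: jacobian_works)
  have "((\<lambda>t. t *\<^sub>R axis v (1::real)) has_derivative (\<lambda>t. t *\<^sub>R axis v 1)) (at (0::real))"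
    by (auto intro!: derivative_eq_intros)
  from has_derivative_compose[OF this deriv]
  have "((\<lambda>t. f (t *\<^sub>R axis v 1) $ c) has_derivative
          (\<lambda>t. (jacobian f (at 0) *v (t *\<^sub>R axis v 1)) $ c)) (at 0)"
    by (rule bounded_linear.has_derivative[OF bounded_linear_vec_nth])
  moreover have "f (t *\<^sub>R axis v 1) $ c = f 0 $ c" for t
  proof -
    have "(t *\<^sub>R axis v 1 :: real ^ _) $ u = 0 $ u" if "u = c \<or> u \<in> neighbors E c" for u
      using that assms by (auto simp: axis_def neighbors_def)
    then show ?thesis
      using f unfolding admissible_def by blast
  qed
  ultimately have "((\<lambda>t::real. f 0 $ c) has_derivative
          (\<lambda>t. (jacobian f (at 0) *v (t *\<^sub>R axis v 1)) $ c)) (at 0)"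
    by simp
  then have "(\<lambda>t. (jacobian f (at 0) *v (t *\<^sub>R axis v 1)) $ c) = (\<lambda>t. 0)"
    by (rule has_derivative_unique) simp
  from fun_cong[OF this, of 1] show ?thesis
    by (simp add: matrix_vector_mult_basis column_def)
qed

theorem proposition4p1:
  fixes E :: "'n::finite \<Rightarrow> 'n \<Rightarrow> bool"
    and f :: "real ^ 'n \<Rightarrow> real ^ 'n"
    and \<alpha> :: real
  assumes "is_tree E"
    and "admissible E f"
    and "f 0 = 0"
    and "\<And>c. internal_coeff f c = \<alpha>"
    and "CARD('n) - 2 * matching_number E > 0"
  shows "is_eigenvalue (jacobian f (at 0)) \<alpha> \<and>
         alg_multiplicity (jacobian f (at 0)) \<alpha> \<ge> CARD('n) - 2 * matching_number E"
proof -
  have mult: "CARD('n) - 2 * matching_number E \<le> alg_multiplicity (jacobian f (at 0)) \<alpha>"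
    using assms(1,2,4)
    by (intro alg_multiplicity_ge_forest)
      (auto simp: is_tree_def internal_coeff_def admissible_jacobian_eq_0)
  \<comment> \<open>A positive root order is what makes \<alpha> an actual root, hence an
    eigenvalue.\<close>
  with assms(5) have "alg_multiplicity (jacobian f (at 0)) \<alpha> \<noteq> 0"
    by linarith
  then have "is_eigenvalue (jacobian f (at 0)) \<alpha>"
    by (simp add: is_eigenvalue_iff_root order_root alg_multiplicity_def)
  with mult show ?thesis
    by simp
qed

end
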